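(* Let $G=(V,E,w)\in\mathbb{G}$ be a weighted directed graph with $V=\{1,\dots,n\}$ and weighted adjacency matrix $M_G(\lambda)$, let $\lambda_0\in\mathbb{C}$, and let $S\subset V$ be a $\lambda_0$-structural set of $G$, with $\overline S=V\setminus S$. Let $u,v\in\mathbb{C}^n$ with $u\neq 0$ satisfy $M_G(\lambda_0)u=\lambda_0u$ and $M_G(\lambda_0)v-\lambda_0v=u$. If there is a $c\in\mathbb{C}$ with $c\neq-1$ such that $$\sum_{l\in\overline S}\frac{R_{i,l}(G,S,\lambda_0)}{\lambda_0-w(l,l)(\lambda_0)}\,u_l=c\,u_i\qquad\text{for all } i\in S,$$ then $$R_S(G,\lambda_0)v_S-\lambda_0v_S=(1+c)u_S,$$ where $u_S=(u_i)_{i\in S}$ and $v_S=(v_i)_{i\in S}$.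
   Context: $\mathbb{W}$ is the field of rational functions $p(\lambda)/q(\lambda)$ with $p,q\in\mathbb{C}[\lambda]$ and $q\not\equiv0$. $\mathbb{G}$ is the class of weighted directed graphs $G=(V,E,w)$ with $V=\{1,\dots,n\}$, $E\subset V\times V$ and $w:E\to\mathbb{W}$; put $w(i,j)=0$ if $(i,j)\notin E$, and $M_G(\lambda)=(w(i,j))_{i,j\in V}$. Writing $M_G(\lambda_0)$ presupposes that the entries are defined (have no pole) at $\lambda_0$. A path $(i_0,\dots,i_p)$, $p\ge1$, is a sequence of distinct vertices (except that $i_0=i_p$ is allowed, in which case it is a cycle) with $(i_l,i_{l+1})\in E$ for $0\le l\le p-1$; a cycle with $p=1$ is a loop. A nonempty $S\subset V$ is a structural set if every cycle of $G$ that is not a loop contains a vertex of $S$ and, for each $i\in\overline S$, $w(i,i)\ne\lambda$ as a rational function. It is a $\lambda_0$-structural set if moreover $w(i,i)(\lambda_0)\neq\lambda_0$ for all $i\in\overline S$. A branch of $(G,S)$ is a path $\beta=(i_0,i_1,\dots,i_p)$ with $i_0,i_p\in V$ and all interior vertices $i_1,\dots,i_{p-1}\in\overline S$. Its weight is $$w(\beta,\lambda)=w(i_0,i_1)\prod_{l=1}^{p-1}\frac{w(i_l,i_{l+1})}{\lambda-w(i_l,i_l)}.$$ For $i,j\in V$, $R_{i,j}(G,S,\lambda)=\sum_\beta w(\beta,\lambda)$, the sum being over all branches $\beta$ from $i$ to $j$. The isospectral reduction is the $|S|\times|S|$ matrix $R_S(G,\lambda)=(R_{i,j}(G,S,\lambda))_{i,j\in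 S}$. *)

theory Defs
  imports "HOL-Analysis.Analysis" "HOL-Computational_Algebra.Computational_Algebra"
begin

type_synonym ratfun = "complex poly fract"

definition ratfun_var :: ratfun where
  "ratfun_var = Fract [:0, 1:] 1"

definition regular_at :: "ratfun \<Rightarrow> complex \<Rightarrow> bool" where
  "regular_at f z \<longleftrightarrow> (\<exists>p q. f = Fract p q \<and> poly q z \<noteq> 0)"

text \<open>Only meaningful where the argument is regular; independence of the representing
  fraction is shown below.\<close>

definition ratfun_eval :: "ratfun \<Rightarrow> complex \<Rightarrow> complex" where
  "ratfun_eval f z = (THE x. \<exists>p q. f = Fract p q \<and> poly q z \<noteq> 0 \<and> x = poly p z / poly q z)"

lemma ratfun_eval_Fract:
  assumes "poly q z \<noteq> 0"
  shows "ratfun_eval (Fract p q) z = poly p z / poly q z"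
  unfolding ratfun_eval_def
proof (rule the_equality)
  show "\<exists>p' q'. Fract p q = Fract p' q' \<and> poly q' z \<noteq> 0 \<and> poly p z / poly q z = poly p' z / poly q' z"
    using assms by blast
next
  fix x
  assume "\<exists>p' q'. Fract p q = Fract p' q' \<and> poly q' z \<noteq> 0 \<and> x = poly p' z / poly q' z"
  then obtain p' q' where *: "Fract p q = Fract p' q'" "poly q' z \<noteq> 0" "x = poly p' z / poly q' z"
    by blast
  have "q \<noteq> 0" "q' \<noteq> 0" using assms * by auto
  with * have "p * q' = p' * q" by (simp add: eq_fract)
  then have "poly p z * poly q' z = poly p' z * poly q z" by (metis poly_mult)
  with * assms show "x = poly p z / poly q z" by (simp add: frac_eq_eq)
qed

text \<open>The vertex set is the whole (finite) type. The raw weight function is only relevant on the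
  edges; \<open>wt\<close> is its extension by zero. An edge may carry the weight zero.\<close>

record 'v wdigraph =
  edges :: "('v \<times> 'v) set"
  weight :: "'v \<Rightarrow> 'v \<Rightarrow> ratfun"

definition wt :: "'v wdigraph \<Rightarrow> 'v \<Rightarrow> 'v \<Rightarrow> ratfun" where
  "wt G i j = (if (i, j) \<in> edges G then weight G i j else 0)"

definition adj_matrix :: "'v::finite wdigraph \<Rightarrow> ratfun ^ 'v ^ 'v" where
  "adj_matrix G = (\<chi> i j. wt G i j)"

definition mat_regular_at :: "ratfun ^ 'm ^ 'n \<Rightarrow> complex \<Rightarrow> bool" where
  "mat_regular_at M z \<longleftrightarrow> (\<forall>i j. regular_at (M $ i $ j) z)"

definition mat_eval :: "ratfun ^ 'm ^ 'n \<Rightarrow> complex \<Rightarrow> complex ^ 'm ^ 'n" where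
  "mat_eval M z = (\<chi> i j. ratfun_eval (M $ i $ j) z)"

text \<open>A path is given by its vertex list. The two distinctness conditions say that the vertices
  are pairwise distinct, except that the first and the last one may coincide.\<close>

definition is_path :: "'v wdigraph \<Rightarrow> 'v list \<Rightarrow> bool" where
  "is_path G xs \<longleftrightarrow> length xs \<ge> 2 \<and> distinct (butlast xs) \<and> distinct (tl xs) \<and>
     (\<forall>l < length xs - 1. (xs ! l, xs ! Suc l) \<in> edges G)"

definition is_cycle :: "'v wdigraph \<Rightarrow> 'v list \<Rightarrow> bool" where
  "is_cycle G xs \<longleftrightarrow> is_path G xs \<and> hd xs = last xs"

definition is_loop :: "'v wdigraph \<Rightarrow> 'v list \<Rightarrow> bool" where
  "is_loop G xs \<longleftrightarrow> is_cycle G xs \<and> length xs = 2"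

definition structural_set :: "'v wdigraph \<Rightarrow> 'v set \<Rightarrow> bool" where
  "structural_set G S \<longleftrightarrow> S \<noteq> {} \<and>
     (\<forall>xs. is_cycle G xs \<and> \<not> is_loop G xs \<longrightarrow> set xs \<inter> S \<noteq> {}) \<and>
     (\<forall>i \<in> - S. wt G i i \<noteq> ratfun_var)"

definition structural_set_at :: "complex \<Rightarrow> 'v wdigraph \<Rightarrow> 'v set \<Rightarrow> bool" where
  "structural_set_at z G S \<longleftrightarrow> structural_set G S \<and> (\<forall>i \<in> - S. ratfun_eval (wt G i i) z \<noteq> z)"

definition is_branch :: "'v wdigraph \<Rightarrow> 'v set \<Rightarrow> 'v list \<Rightarrow> bool" where
  "is_branch G S xs \<longleftrightarrow> is_path G xs \<and> set (butlast (tl xs)) \<subseteq> - S"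

definition branches :: "'v wdigraph \<Rightarrow> 'v set \<Rightarrow> 'v \<Rightarrow> 'v \<Rightarrow> 'v list set" where
  "branches G S i j = {xs. is_branch G S xs \<and> hd xs = i \<and> last xs = j}"

definition branch_weight :: "'v wdigraph \<Rightarrow> 'v list \<Rightarrow> ratfun" where
  "branch_weight G xs = wt G (xs ! 0) (xs ! 1) *
     (\<Prod>l = 1..<length xs - 1. wt G (xs ! l) (xs ! Suc l) / (ratfun_var - wt G (xs ! l) (xs ! l)))"

definition branch_sum :: "'v wdigraph \<Rightarrow> 'v set \<Rightarrow> 'v \<Rightarrow> 'v \<Rightarrow> ratfun" where
  "branch_sum G S i j = (\<Sum>xs \<in> branches G S i j. branch_weight G xs)"

lemma finite_branches:
  fixes G :: "'v::finite wdigraph"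
  shows "finite (branches G S i j)"
proof (rule finite_subset)
  show "branches G S i j \<subseteq> {xs. set xs \<subseteq> UNIV \<and> length xs \<le> Suc CARD('v)}"
  proof clarsimp
    fix xs assume "xs \<in> branches G S i j"
    then have "distinct (tl xs)" by (simp add: branches_def is_branch_def is_path_def)
    then have "length (tl xs) = card (set (tl xs))" by (simp add: distinct_card)
    also have "\<dots> \<le> CARD('v)" by (rule card_mono) auto
    finally show "length xs \<le> Suc CARD('v)" by simp
  qed
  show "finite {xs :: 'v list. set xs \<subseteq> UNIV \<and> length xs \<le> Suc CARD('v)}"
    by (rule finite_lists_length_le) simp
qed

text \<open>A matrix indexed by \<open>S \<times> S\<close> is a function of two arguments, \<open>undefined\<close> outside of \<open>S\<close>.\<close>

definition isospectral_reduction :: "'v wdigraph \<Rightarrow> 'v set \<Rightarrow> 'v \<Rightarrow> 'v \<Rightarrow> ratfun" where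
  "isospectral_reduction G S = (\<lambda>i\<in>S. \<lambda>j\<in>S. branch_sum G S i j)"

end

theory Submission imports Defs begin

text \<open>
  Write \<open>a\<^sub>i\<^sub>j\<close> for the entries of the adjacency matrix at \<open>\<lambda>\<^sub>0\<close>, fix \<open>i \<in> S\<close>, and put
  \<open>x\<^sub>l = R\<^sub>i\<^sub>l / (\<lambda>\<^sub>0 - a\<^sub>l\<^sub>l)\<close> for \<open>l \<notin> S\<close>. The graph theory enters only through a recursion obtained
  by cutting off the last edge of a branch: every branch from \<open>i\<close> to \<open>j\<close> is either the single edge
  \<open>(i, j)\<close> or a branch from \<open>i\<close> to some \<open>l \<notin> S\<close>, \<open>l \<noteq> j\<close>, followed by the edge \<open>(l, j)\<close>, and
  conversely each such extension is again a branch, since the only repetition besides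
  \<open>j = i\<close> would close a cycle, not a loop, that avoids \<open>S\<close> (\<open>branches_last_step\<close>, \<open>branch_sum_last_step\<close>). Therefore
  \<open>R\<^sub>i\<^sub>j = a\<^sub>i\<^sub>j + (\<Sum>l \<notin> S, l \<noteq> j. x\<^sub>l a\<^sub>l\<^sub>j)\<close>.

  For \<open>j \<in> S\<close> this expresses the entries of the reduction by the numbers \<open>x\<^sub>l\<close>. For \<open>j \<notin> S\<close> the
  left-hand side is \<open>x\<^sub>j (\<lambda>\<^sub>0 - a\<^sub>j\<^sub>j)\<close>, so the missing term \<open>l = j\<close> can be added on both sides, which
  gives \<open>\<lambda>\<^sub>0 x\<^sub>j = a\<^sub>i\<^sub>j + (\<Sum>l \<notin> S. x\<^sub>l a\<^sub>l\<^sub>j)\<close>: the row \<open>x\<close> is what eliminates the columns outside of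
  \<open>S\<close> from the \<open>i\<close>-th row of \<open>M - \<lambda>\<^sub>0\<close>. Adding to the \<open>i\<close>-th equation of
  \<open>(M - \<lambda>\<^sub>0) v = u\<close> the combination of the equations outside of \<open>S\<close> with coefficients \<open>x\<^sub>l\<close>
  leaves the \<open>i\<close>-th row of the reduction on the left, applied to \<open>v\<close>, and
  \<open>u\<^sub>i + (\<Sum>l \<notin> S. x\<^sub>l u\<^sub>l)\<close> on the right (\<open>eliminated_row\<close>). The hypothesis on \<open>c\<close> says
  that the last sum is \<open>c u\<^sub>i\<close>.

  The recursion is an identity of rational functions. It may be evaluated at \<open>\<lambda>\<^sub>0\<close> because
  evaluation is a ring homomorphism on the rational functions without a pole there, and the
  denominators \<open>\<lambda> - w(l,l)\<close> with \<open>l \<notin> S\<close> do not vanish at \<open>\<lambda>\<^sub>0\<close>.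
\<close>

section \<open>Evaluation of rational functions at a regular point\<close>

text \<open>Regularity and the value are always needed together, so they are combined in one relation,
  for which the closure properties of the local ring at \<open>z\<close> can be stated as introduction
  rules.\<close>

definition has_value_at :: "ratfun \<Rightarrow> complex \<Rightarrow> complex \<Rightarrow> bool" where
  "has_value_at f z x \<longleftrightarrow> regular_at f z \<and> ratfun_eval f z = x"

lemma has_value_at_iff_Fract:
  "has_value_at f z x \<longleftrightarrow> (\<exists>p q. f = Fract p q \<and> poly q z \<noteq> 0 \<and> x = poly p z / poly q z)"
  unfolding has_value_at_def regular_at_def using ratfun_eval_Fract by blast

lemma has_value_at_ratfun_eval: "regular_at f z \<Longrightarrow> has_value_at f z (ratfun_eval f z)"
  by (simp add: has_value_at_def)

lemma has_value_at_FractI: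
  "f = Fract p q \<Longrightarrow> poly q z \<noteq> 0 \<Longrightarrow> x = poly p z / poly q z \<Longrightarrow> has_value_at f z x"
  unfolding has_value_at_iff_Fract by blast

lemma has_value_at_0: "has_value_at 0 z 0"
  by (rule has_value_at_FractI[of _ 0 1]) (auto simp: Zero_fract_def)

lemma has_value_at_1: "has_value_at 1 z 1"
  by (rule has_value_at_FractI[of _ 1 1]) (auto simp: One_fract_def)

lemma has_value_at_ratfun_var: "has_value_at ratfun_var z z"
  by (rule has_value_at_FractI[of _ "[:0, 1:]" 1]) (auto simp: ratfun_var_def)

lemma has_value_at_add:
  assumes "has_value_at f z x" "has_value_at g z y"
  shows "has_value_at (f + g) z (x + y)"
proof -
  obtain p q p' q' where *: "f = Fract p q" "poly q z \<noteq> 0" "x = poly p z / poly q z"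
    "g = Fract p' q'" "poly q' z \<noteq> 0" "y = poly p' z / poly q' z"
    using assms unfolding has_value_at_iff_Fract by blast
  then have "q \<noteq> 0" "q' \<noteq> 0" by auto
  with * show ?thesis
    by (intro has_value_at_FractI[of _ "p * q' + p' * q" "q * q'"]) (auto simp: add_frac_eq)
qed

lemma has_value_at_diff:
  assumes "has_value_at f z x" "has_value_at g z y"
  shows "has_value_at (f - g) z (x - y)"
proof -
  obtain p q p' q' where *: "f = Fract p q" "poly q z \<noteq> 0" "x = poly p z / poly q z"
    "g = Fract p' q'" "poly q' z \<noteq> 0" "y = poly p' z / poly q' z"
    using assms unfolding has_value_at_iff_Fract by blast
  then have "q \<noteq> 0" "q' \<noteq> 0" by auto
  with * show ?thesis
    by (intro has_value_at_FractI[of _ "p * q' - p' * q" "q * q'"]) (auto simp: diff_frac_eq)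
qed

lemma has_value_at_mult:
  assumes "has_value_at f z x" "has_value_at g z y"
  shows "has_value_at (f * g) z (x * y)"
proof -
  obtain p q p' q' where *: "f = Fract p q" "poly q z \<noteq> 0" "x = poly p z / poly q z"
    "g = Fract p' q'" "poly q' z \<noteq> 0" "y = poly p' z / poly q' z"
    using assms unfolding has_value_at_iff_Fract by blast
  then show ?thesis
    by (intro has_value_at_FractI[of _ "p * p'" "q * q'"]) auto
qed

lemma has_value_at_divide:
  assumes "has_value_at f z x" "has_value_at g z y" "y \<noteq> 0"
  shows "has_value_at (f / g) z (x / y)"
proof -
  obtain p q p' q' where *: "f = Fract p q" "poly q z \<noteq> 0" "x = poly p z / poly q z"
    "g = Fract p' q'" "poly q' z \<noteq> 0" "y = poly p' z / poly q' z"
    using assms unfolding has_value_at_iff_Fract by blast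
  with \<open>y \<noteq> 0\<close> show ?thesis
    by (intro has_value_at_FractI[of _ "p * q'" "q * p'"]) auto
qed

lemma has_value_at_sum:
  assumes "\<And>k. k \<in> A \<Longrightarrow> has_value_at (f k) z (x k)"
  shows "has_value_at (\<Sum>k\<in>A. f k) z (\<Sum>k\<in>A. x k)"
  using assms
  by (induction A rule: infinite_finite_induct) (auto intro: has_value_at_0 has_value_at_add)

lemma has_value_at_prod:
  assumes "\<And>k. k \<in> A \<Longrightarrow> has_value_at (f k) z (x k)"
  shows "has_value_at (\<Prod>k\<in>A. f k) z (\<Prod>k\<in>A. x k)"
  using assms
  by (induction A rule: infinite_finite_induct) (auto intro: has_value_at_1 has_value_at_mult)

section \<open>Cutting off the last edge of a branch\<close>

lemma is_path_iff_successively: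
  "is_path G xs \<longleftrightarrow> length xs \<ge> 2 \<and> distinct (butlast xs) \<and> distinct (tl xs) \<and>
     successively (\<lambda>a b. (a, b) \<in> edges G) xs"
  unfolding is_path_def successively_conv_nth by (auto simp: less_diff_conv)

text \<open>If \<open>j\<close> had been visited, the part of \<open>ys\<close> from \<open>j\<close> on would be closed by the edge to \<open>j\<close> to a
  cycle that avoids \<open>S\<close>; it would not be a loop, because the last vertex of \<open>ys\<close> differs from
  \<open>j\<close>.\<close>

lemma structural_set_no_return:
  assumes S: "structural_set G S"
    and ys: "distinct ys" "set ys \<subseteq> - S" "successively (\<lambda>a b. (a, b) \<in> edges G) ys" "ys \<noteq> []"
    and j: "(last ys, j) \<in> edges G" "last ys \<noteq> j"
  shows "j \<notin> set ys"
proof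
  assume "j \<in> set ys"
  then obtain as bs where split: "ys = as @ j # bs" by (meson split_list)
  with j have "bs \<noteq> []" by auto
  let ?cyc = "j # bs @ [j]"
  have "successively (\<lambda>a b. (a, b) \<in> edges G) ((j # bs) @ [j])"
    using ys j \<open>bs \<noteq> []\<close> unfolding split successively_append_iff by auto
  then have "is_cycle G ?cyc" "\<not> is_loop G ?cyc"
    using ys \<open>bs \<noteq> []\<close>
    by (auto simp: split is_cycle_def is_loop_def is_path_iff_successively butlast_append
        Suc_le_eq)
  then have "set ?cyc \<inter> S \<noteq> {}" using S unfolding structural_set_def by blast
  then show False using ys split by auto
qed

text \<open>Since \<open>l \<notin> S\<close>, all vertices of the given branch except \<open>i\<close> lie outside of \<open>S\<close>, so that
  \<open>structural_set_no_return\<close> applies to them. A return to the start, \<open>j = i\<close>, is possible and makes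
  the extended branch a cycle.\<close>

lemma branch_append:
  assumes S: "structural_set G S" and i: "i \<in> S" and l: "l \<in> - S" "l \<noteq> j" "(l, j) \<in> edges G"
    and xs: "xs \<in> branches G S i l"
  shows "xs @ [j] \<in> branches G S i j"
proof -
  obtain ys where split: "xs = i # ys" and "ys \<noteq> []" and last: "last ys = l"
    and path: "distinct ys" "successively (\<lambda>a b. (a, b) \<in> edges G) xs" "set (butlast ys) \<subseteq> - S"
    using xs by (cases xs) (auto simp: branches_def is_branch_def is_path_iff_successively
        split: if_splits)
  have "set ys = insert l (set (butlast ys))"
    using \<open>ys \<noteq> []\<close> last by (metis append_butlast_last_id list.set(1,2) set_append
        Un_insert_right sup_bot_right)
  then have ys: "set ys \<subseteq> - S" using path l by auto
  have "successively (\<lambda>a b. (a, b) \<in> edges G) ys"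
    using path split by (cases ys) auto
  then have "j \<notin> set ys"
    using structural_set_no_return[OF S] path ys \<open>ys \<noteq> []\<close> last l by metis
  moreover have "i \<notin> set ys" using i ys by auto
  moreover have "successively (\<lambda>a b. (a, b) \<in> edges G) (xs @ [j])"
    unfolding successively_append_iff using path last l split \<open>ys \<noteq> []\<close> by auto
  ultimately show ?thesis
    using path ys \<open>ys \<noteq> []\<close>
    by (auto simp: branches_def is_branch_def is_path_iff_successively split butlast_append)
qed

lemma branch_cases:
  assumes "xs \<in> branches G S i j"
  obtains (edge) "xs = [i, j]" "(i, j) \<in> edges G"
  | (append) l ys where "xs = ys @ [j]" "ys \<in> branches G S i l" "l \<in> - S" "l \<noteq> j" "(l, j) \<in> edges G"
proof -
  have xs: "is_path G xs" "set (butlast (tl xs)) \<subseteq> - S" "hd xs = i" "last xs = j"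
    using assms by (auto simp: branches_def is_branch_def)
  then obtain zs where "xs = i # zs"
    by (cases xs) (auto simp: is_path_def)
  with xs(1) have zs: "xs = i # zs" "zs \<noteq> []" by (auto simp: is_path_def)
  define ms where "ms = butlast zs"
  have split: "xs = i # ms @ [j]" using zs xs unfolding ms_def by auto
  show thesis
  proof (cases ms rule: rev_cases)
    case Nil
    then show thesis using xs split edge by (auto simp: is_path_iff_successively)
  next
    case (snoc ks l)
    have "i # ms \<in> branches G S i l"
      using xs unfolding split snoc
      by (auto simp: branches_def is_branch_def is_path_iff_successively butlast_append
          successively_append_iff successively_Cons hd_append split: if_splits)
    moreover have "l \<in> - S" "l \<noteq> j" "(l, j) \<in> edges G"
      using xs unfolding split snoc
      by (auto simp: is_path_iff_successively butlast_append
          successively_append_iff successively_Cons hd_append split: if_splits)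
    ultimately show thesis using append[of "i # ms" l] split by simp
  qed
qed

lemma branches_last_step:
  assumes "structural_set G S" "i \<in> S"
  shows "branches G S i j = (if (i, j) \<in> edges G then {[i, j]} else {}) \<union>
    (\<Union>l \<in> {l \<in> - S. l \<noteq> j \<and> (l, j) \<in> edges G}. (\<lambda>xs. xs @ [j]) ` branches G S i l)"
    (is "_ = ?E \<union> ?A")
proof
  show "branches G S i j \<subseteq> ?E \<union> ?A"
  proof
    fix xs assume "xs \<in> branches G S i j"
    then show "xs \<in> ?E \<union> ?A" by (cases rule: branch_cases) auto
  qed
  have "[i, j] \<in> branches G S i j" if "(i, j) \<in> edges G"
    using that by (auto simp: branches_def is_branch_def is_path_iff_successively)
  then show "?E \<union> ?A \<subseteq> branches G S i j"
    using branch_append[OF assms] by auto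
qed

lemma branch_weight_append:
  assumes "xs \<in> branches G S i l"
  shows "branch_weight G (xs @ [j]) =
    branch_weight G xs * (wt G l j / (ratfun_var - wt G l l))"
proof -
  have len: "length xs \<ge> 2" and last: "last xs = l"
    using assms by (auto simp: branches_def is_branch_def is_path_def)
  define n where "n = length xs - 1"
  have n: "length xs = Suc n" "1 \<le> n" using len by (auto simp: n_def)
  have l: "xs ! n = l" using last len by (metis n_def last_conv_nth list.size(3) not_numeral_le_zero)
  have "(\<Prod>k = 1..<n. wt G ((xs @ [j]) ! k) ((xs @ [j]) ! Suc k) /
          (ratfun_var - wt G ((xs @ [j]) ! k) ((xs @ [j]) ! k))) =
        (\<Prod>k = 1..<n. wt G (xs ! k) (xs ! Suc k) / (ratfun_var - wt G (xs ! k) (xs ! k)))"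
    using n by (intro prod.cong) (auto simp: nth_append)
  moreover have "(xs @ [j]) ! 0 = xs ! 0" "(xs @ [j]) ! 1 = xs ! 1" "(xs @ [j]) ! n = l"
    "(xs @ [j]) ! Suc n = j"
    using n l by (auto simp: nth_append)
  ultimately show ?thesis
    unfolding branch_weight_def using n by (simp add: prod.atLeastLessThan_Suc mult.assoc)
qed

text \<open>The summation runs over all \<open>l \<noteq> j\<close> outside of \<open>S\<close>, also those without an edge to \<open>j\<close>, for
  which the weight is zero. The term \<open>l = j\<close> has to be left out because a branch may not run
  through a loop.\<close>

lemma branch_sum_last_step:
  fixes G :: "'v::finite wdigraph"
  assumes "structural_set G S" "i \<in> S"
  shows "branch_sum G S i j = wt G i j +
    (\<Sum>l \<in> - S - {j}. branch_sum G S i l * (wt G l j / (ratfun_var - wt G l l)))"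
proof -
  let ?E = "if (i, j) \<in> edges G then {[i, j]} else {}"
  let ?L = "{l \<in> - S. l \<noteq> j \<and> (l, j) \<in> edges G}"
  let ?A = "\<lambda>l. (\<lambda>xs. xs @ [j]) ` branches G S i l"
  have ends: "length xs \<ge> 2 \<and> last xs = l" if "xs \<in> branches G S i l" for xs l
    using that by (auto simp: branches_def is_branch_def is_path_def)
  then have "[i, j] \<notin> ?A l" for l
    by (fastforce simp: Cons_eq_append_conv)
  then have disj_edge: "?E \<inter> (\<Union>l\<in>?L. ?A l) = {}" by simp
  \<comment> \<open>the second to last vertex of an extended branch determines the index \<open>l\<close>\<close>
  have disj: "\<forall>l\<in>?L. \<forall>l'\<in>?L. l \<noteq> l' \<longrightarrow> ?A l \<inter> ?A l' = {}"
    by (auto dest: ends)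
  have finite_ext: "finite (?A l)" for l by (simp add: finite_branches)
  have "branch_sum G S i j = sum (branch_weight G) ?E + sum (branch_weight G) (\<Union>l\<in>?L. ?A l)"
    unfolding branch_sum_def
    by (subst branches_last_step[OF assms], rule sum.union_disjoint)
      (use disj_edge finite_ext in simp_all)
  also have "sum (branch_weight G) ?E = wt G i j"
    by (simp add: branch_weight_def wt_def)
  also have "sum (branch_weight G) (\<Union>l\<in>?L. ?A l) = (\<Sum>l\<in>?L. sum (branch_weight G) (?A l))"
    by (rule sum.UNION_disjoint) (use disj finite_ext in simp_all)
  also have "\<dots> = (\<Sum>l\<in>?L. branch_sum G S i l * (wt G l j / (ratfun_var - wt G l l)))"
    by (rule sum.cong)
      (simp_all add: branch_sum_def sum_distrib_right sum_divide_distrib sum.reindex inj_on_def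
        branch_weight_append)
  also have "\<dots> = (\<Sum>l \<in> - S - {j}. branch_sum G S i l * (wt G l j / (ratfun_var - wt G l l)))"
    by (rule sum.mono_neutral_left) (auto simp: wt_def)
  finally show ?thesis .
qed

section \<open>The recursion at a point\<close>

text \<open>The denominators of a branch weight belong to interior vertices, hence to vertices outside of
  \<open>S\<close>, where they do not vanish at \<open>z\<close>.\<close>

lemma branch_sum_regular_at:
  fixes G :: "'v::finite wdigraph"
  assumes reg: "\<And>i j. regular_at (wt G i j) z"
    and S: "\<And>l. l \<in> - S \<Longrightarrow> ratfun_eval (wt G l l) z \<noteq> z"
  shows "regular_at (branch_sum G S i j) z"
proof -
  note wt = has_value_at_ratfun_eval[OF reg]
  have "regular_at (branch_weight G xs) z" if "xs \<in> branches G S i j" for xs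
  proof -
    have interior: "xs ! l \<in> - S" if "l \<in> {1..<length xs - 1}" for l
    proof -
      have "xs ! l = butlast (tl xs) ! (l - 1)" "l - 1 < length (butlast (tl xs))"
        using that by (auto simp: nth_butlast nth_tl)
      then have "xs ! l \<in> set (butlast (tl xs))" by (metis nth_mem)
      then show ?thesis using \<open>xs \<in> branches G S i j\<close> by (auto simp: branches_def is_branch_def)
    qed
    let ?f = "\<lambda>l. wt G (xs ! l) (xs ! Suc l) / (ratfun_var - wt G (xs ! l) (xs ! l))"
    have "has_value_at (?f l) z (ratfun_eval (?f l) z)" if "l \<in> {1..<length xs - 1}" for l
    proof -
      have "has_value_at (?f l) z (ratfun_eval (wt G (xs ! l) (xs ! Suc l)) z /
          (z - ratfun_eval (wt G (xs ! l) (xs ! l)) z))"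
        using S[OF interior[OF that]]
        by (intro has_value_at_divide has_value_at_diff has_value_at_ratfun_var wt) auto
      then show ?thesis by (simp add: has_value_at_def)
    qed
    then have "has_value_at (branch_weight G xs) z (ratfun_eval (wt G (xs ! 0) (xs ! 1)) z *
        (\<Prod>l = 1..<length xs - 1. ratfun_eval (?f l) z))"
      unfolding branch_weight_def by (intro has_value_at_mult has_value_at_prod wt)
    then show ?thesis by (simp add: has_value_at_def)
  qed
  then have "has_value_at (branch_sum G S i j) z
      (\<Sum>xs \<in> branches G S i j. ratfun_eval (branch_weight G xs) z)"
    unfolding branch_sum_def by (intro has_value_at_sum has_value_at_ratfun_eval)
  then show ?thesis by (simp add: has_value_at_def)
qed

lemma ratfun_eval_branch_sum_last_step:
  fixes G :: "'v::finite wdigraph"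
  assumes reg: "\<And>i j. regular_at (wt G i j) z"
    and S: "structural_set_at z G S" and i: "i \<in> S"
  shows "ratfun_eval (branch_sum G S i j) z = ratfun_eval (wt G i j) z +
    (\<Sum>l \<in> - S - {j}. ratfun_eval (branch_sum G S i l) z / (z - ratfun_eval (wt G l l) z)
       * ratfun_eval (wt G l j) z)"
proof -
  have ne: "ratfun_eval (wt G l l) z \<noteq> z" if "l \<in> - S" for l
    using S that by (auto simp: structural_set_at_def)
  then have den: "z - ratfun_eval (wt G l l) z \<noteq> 0" if "l \<in> - S" for l
    using that by fastforce
  have "structural_set G S" using S by (simp add: structural_set_at_def)
  note wt = has_value_at_ratfun_eval[OF reg]
  note branch_sum = has_value_at_ratfun_eval[OF branch_sum_regular_at[OF reg ne]]
  have "has_value_at (wt G i j +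
      (\<Sum>l \<in> - S - {j}. branch_sum G S i l * (wt G l j / (ratfun_var - wt G l l)))) z
    (ratfun_eval (wt G i j) z +
      (\<Sum>l \<in> - S - {j}. ratfun_eval (branch_sum G S i l) z *
         (ratfun_eval (wt G l j) z / (z - ratfun_eval (wt G l l) z))))"
    by (intro has_value_at_add has_value_at_sum has_value_at_mult has_value_at_divide
        has_value_at_diff has_value_at_ratfun_var wt branch_sum)
      (use den in blast)+
  then show ?thesis
    by (subst branch_sum_last_step[OF \<open>structural_set G S\<close> i]) (simp add: has_value_at_def)
qed

section \<open>Eliminating the vertices outside of the structural set\<close>

text \<open>This is the elimination step of the overview for a single row of an arbitrary matrix: \<open>r\<close> is
  the reduced row, and the right-hand side is the corresponding combination of the entries of
  \<open>M v - z v\<close>.\<close>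

lemma eliminated_row:
  fixes a :: "'v::finite \<Rightarrow> 'v \<Rightarrow> 'a::field"
  assumes ne: "\<And>l. l \<in> - S \<Longrightarrow> a l l \<noteq> z"
    and x: "\<And>l. l \<in> - S \<Longrightarrow> x l = r l / (z - a l l)"
    and r: "\<And>j. r j = a i j + (\<Sum>l \<in> - S - {j}. x l * a l j)"
  shows "(\<Sum>j\<in>S. r j * v j) - z * v i =
    ((\<Sum>j\<in>UNIV. a i j * v j) - z * v i) +
    (\<Sum>l\<in>-S. x l * ((\<Sum>j\<in>UNIV. a l j * v j) - z * v l))"
proof -
  have split: "(\<Sum>j\<in>UNIV. f j) = (\<Sum>j\<in>S. f j) + (\<Sum>j\<in>-S. f j)" for f :: "'v \<Rightarrow> 'a"
    using sum.union_disjoint[of S "- S" f] by simp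
  have in_S: "r j = a i j + (\<Sum>l\<in>-S. x l * a l j)" if "j \<in> S" for j
    using r[of j] that by simp
  have out_S: "a i j + (\<Sum>l\<in>-S. x l * a l j) = z * x j" if "j \<in> - S" for j
  proof -
    have "(\<Sum>l\<in>-S. x l * a l j) = x j * a j j + (\<Sum>l \<in> - S - {j}. x l * a l j)"
      using that by (intro sum.remove) auto
    moreover have "r j = x j * (z - a j j)" using ne[OF that] x[OF that] by simp
    ultimately show ?thesis using r[of j] by (simp add: algebra_simps)
  qed
  have "(\<Sum>j\<in>UNIV. a i j * v j) + (\<Sum>l\<in>-S. x l * (\<Sum>j\<in>UNIV. a l j * v j)) =
      (\<Sum>j\<in>UNIV. a i j * v j) + (\<Sum>j\<in>UNIV. \<Sum>l\<in>-S. x l * (a l j * v j))"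
    unfolding sum_distrib_left by (subst sum.swap) (rule refl)
  also have "\<dots> = (\<Sum>j\<in>UNIV. (a i j + (\<Sum>l\<in>-S. x l * a l j)) * v j)"
    by (simp add: sum.distrib sum_distrib_right distrib_right mult.assoc)
  also have "\<dots> = (\<Sum>j\<in>S. r j * v j) + (\<Sum>j\<in>-S. z * x j * v j)"
    unfolding split by (intro arg_cong2[of _ _ _ _ "(+)"] sum.cong) (simp_all add: in_S out_S)
  finally show ?thesis
    by (simp add: right_diff_distrib sum_subtractf algebra_simps)
qed

theorem theorem1:
  fixes G :: "'v::finite wdigraph" and S :: "'v set" and z0 c :: complex
    and u v :: "complex ^ 'v"
  assumes "mat_regular_at (adj_matrix G) z0"
    and "structural_set_at z0 G S"
    and "u \<noteq> 0"
    and "mat_eval (adj_matrix G) z0 *v u = z0 *s u"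
    and "mat_eval (adj_matrix G) z0 *v v - z0 *s v = u"
    and "c \<noteq> - 1"
    and "\<forall>i\<in>S. (\<Sum>l\<in>- S. ratfun_eval (branch_sum G S i l) z0
            / (z0 - ratfun_eval (wt G l l) z0) * u $ l) = c * u $ i"
  shows "\<forall>i\<in>S. (\<Sum>j\<in>S. ratfun_eval (isospectral_reduction G S i j) z0 * v $ j) - z0 * v $ i
            = (1 + c) * u $ i"
proof
  fix i assume i: "i \<in> S"
  let ?a = "\<lambda>i j. ratfun_eval (wt G i j) z0"
  let ?r = "\<lambda>j. ratfun_eval (branch_sum G S i j) z0"
  let ?x = "\<lambda>l. ?r l / (z0 - ?a l l)"
  have reg: "regular_at (wt G i j) z0" for i j
    using assms(1) by (simp add: mat_regular_at_def adj_matrix_def)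
  have ne: "?a l l \<noteq> z0" if "l \<in> - S" for l
    using assms(2) that by (auto simp: structural_set_at_def)
  have row: "(\<Sum>j\<in>UNIV. ?a l j * v $ j) - z0 * v $ l = u $ l" for l
    unfolding assms(5)[symmetric]
    by (simp add: mat_eval_def adj_matrix_def matrix_vector_mult_def)
  have "(\<Sum>j\<in>S. ?r j * v $ j) - z0 * v $ i = u $ i + (\<Sum>l\<in>-S. ?x l * u $ l)"
    using eliminated_row[of S ?a z0 ?x ?r i "($) v", OF ne refl
        ratfun_eval_branch_sum_last_step[OF reg assms(2) i]]
    by (simp only: row)
  also have "\<dots> = (1 + c) * u $ i"
    using assms(7) i by (simp add: algebra_simps)
  finally show "(\<Sum>j\<in>S. ratfun_eval (isospectral_reduction G S i j) z0 * v $ j) - z0 * v $ i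
      = (1 + c) * u $ i"
    using i by (simp add: isospectral_reduction_def)
qed

end
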